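(* Let $P,Q\in\mathbb Z$ with $Q=\pm1$ and $\Delta=P^2+4Q>0$, and assume the Lucas sequence $U_n=U_n(P,Q)$ is nondegenerate. Let $m,n$ be positive integers with $\gcd(m,n)=1$ and suppose that $$\Delta y^2=U_mU_n$$ for some $y\in\mathbb Z$. Then $$[U_m],[U_n]\in G_\Delta,\qquad [U_m][U_n]=[\Delta].$$ Thus the square classes of the two terms lie in the finite group $G_\Delta$ and satisfy the compatibility condition determined by $[\Delta]$.
   Context: The Lucas sequence $U_n=U_n(P,Q)$ is defined by $U_0=0$, $U_1=1$, $U_{n+2}=PU_{n+1}+QU_n$. Let $\alpha,\beta$ be the roots of $x^2-Px-Q$. The sequence is nondegenerate if $\alpha/\beta$ is not a root of unity (then $U_n\neq0$ for $n\ge1$). $[x]$ denotes the class of $x\in\mathbb Q^\times$ in $\mathbb Q^\times/(\mathbb Q^\times)^2$, and $G_\Delta=\langle -1,\ p:p\mid\Delta\rangle\subseteq\mathbb Q^\times/(\mathbb Q^\times)^2$, with $p$ running over rational primes dividing $\Delta$. *)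

theory Defs
  imports
    Complex_Main
    "HOL-Computational_Algebra.Polynomial"
    "HOL-Computational_Algebra.Primes"
    "HOL-Algebra.Generated_Groups"
begin

text \<open>Note the sign convention: the characteristic polynomial is \<open>x\<^sup>2 - P x - Q\<close>.\<close>

fun lucas_U :: "int \<Rightarrow> int \<Rightarrow> nat \<Rightarrow> int" where
  "lucas_U P Q 0 = 0"
| "lucas_U P Q (Suc 0) = 1"
| "lucas_U P Q (Suc (Suc n)) = P * lucas_U P Q (Suc n) + Q * lucas_U P Q n"

text \<open>The polynomial identity says that \<open>\<alpha>, \<beta>\<close> are the roots of \<open>x\<^sup>2 - P x - Q\<close> with multiplicity,
  so a double root gives the ratio 1 and counts as degenerate. The condition \<open>Q \<noteq> 0\<close> makes both
  roots nonzero, so that the quotient is meaningful.\<close>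

definition lucas_nondegenerate :: "int \<Rightarrow> int \<Rightarrow> bool" where
  "lucas_nondegenerate P Q \<longleftrightarrow> Q \<noteq> 0 \<and>
     (\<forall>\<alpha> \<beta> :: complex. [:- of_int Q, - of_int P, 1:] = [:- \<alpha>, 1:] * [:- \<beta>, 1:] \<longrightarrow>
        \<not> (\<exists>k>0. (\<alpha> / \<beta>) ^ k = 1))"

definition rat_units :: "rat monoid" where
  "rat_units = \<lparr>carrier = UNIV - {0}, monoid.mult = (*), one = 1\<rparr>"

definition rat_squares :: "rat set" where
  "rat_squares = {x\<^sup>2 | x. x \<noteq> 0}"

lemma comm_group_rat_units: "comm_group rat_units"
  by (rule comm_groupI) (auto simp: rat_units_def intro!: bexI[of _ "inverse _"])

lemma subgroup_rat_squares: "subgroup rat_squares rat_units"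
proof -
  interpret comm_group rat_units by (rule comm_group_rat_units)
  have inv_eq: "inv\<^bsub>rat_units\<^esub> x = inverse x" if "x \<noteq> 0" for x
    using that by (intro inv_equality) (auto simp: rat_units_def)
  show ?thesis
  proof (rule subgroupI)
    show "rat_squares \<subseteq> carrier rat_units"
      by (auto simp: rat_squares_def rat_units_def)
    show "rat_squares \<noteq> {}"
      by (auto simp: rat_squares_def intro: exI[of _ 1])
  next
    fix a assume "a \<in> rat_squares"
    then obtain x where "a = x\<^sup>2" "x \<noteq> 0" by (auto simp: rat_squares_def)
    then show "inv\<^bsub>rat_units\<^esub> a \<in> rat_squares"
      by (auto simp: inv_eq rat_squares_def power_inverse intro!: exI[of _ "inverse x"])
  next
    fix a b assume "a \<in> rat_squares" "b \<in> rat_squares"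
    then obtain x y where "a = x\<^sup>2" "x \<noteq> 0" "b = y\<^sup>2" "y \<noteq> 0" by (auto simp: rat_squares_def)
    then show "a \<otimes>\<^bsub>rat_units\<^esub> b \<in> rat_squares"
      by (auto simp: rat_units_def rat_squares_def power_mult_distrib intro!: exI[of _ "x * y"])
  qed
qed

definition rat_square_classes :: "rat set monoid" where
  "rat_square_classes = rat_units Mod rat_squares"

lemma comm_group_rat_square_classes: "comm_group rat_square_classes"
  unfolding rat_square_classes_def
  by (rule comm_group.abelian_FactGroup[OF comm_group_rat_units subgroup_rat_squares])

text \<open>Only meaningful for nonzero arguments: \<open>sq_class 0 = {0}\<close> is not an element of
  \<open>rat_square_classes\<close>.\<close>

definition sq_class :: "rat \<Rightarrow> rat set" where
  "sq_class x = rat_squares #>\<^bsub>rat_units\<^esub> x"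

definition G_sub :: "int \<Rightarrow> rat set set" where
  "G_sub \<Delta> = generate rat_square_classes
     (insert (sq_class (- 1)) {sq_class (of_int p) | p :: int. prime p \<and> p dvd \<Delta>})"

end

theory Submission
  imports Defs
begin

text \<open>
  Since \<open>P\<close> and \<open>Q = \<plusminus>1\<close> are coprime, \<open>(U\<^sub>n)\<close> is a strong divisibility sequence, so \<open>U\<^sub>m\<close> and \<open>U\<^sub>n\<close>
  are coprime for coprime indices (\<open>gcd_lucas_U\<close>); nondegeneracy makes both nonzero, by
  Binet's formula (\<open>lucas_U_nonzero\<close>). Reading \<open>\<Delta> y\<^sup>2 = U\<^sub>m U\<^sub>n\<close> modulo squares gives the identity
  \<open>[U\<^sub>m][U\<^sub>n] = [\<Delta>]\<close>.

  Consider a prime \<open>q\<close> that does not divide \<open>\<Delta>\<close>. It has even valuation in \<open>U\<^sub>m U\<^sub>n\<close> and divides at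
  most one of the two factors, so it has even valuation in each of them. Hence each factor is, up
  to sign and squares, a product of primes dividing \<open>\<Delta>\<close>. Instead of comparing valuations,
  \<open>sq_class_coprime_factor\<close> argues by descent, removing from the equation either one prime
  divisor of \<open>\<Delta>\<close> or the square of another prime. Finally, \<open>G\<^sub>\<Delta>\<close> is finite because it is finitely
  generated, commutative and of exponent 2.
\<close>

section \<open>Lucas sequences\<close>

lemma lucas_U_add:
  "lucas_U P Q (Suc (m + n)) =
     lucas_U P Q (Suc m) * lucas_U P Q (Suc n) + Q * lucas_U P Q m * lucas_U P Q n"
proof (induction n rule: induct_nat_012)
  case 1
  then show ?case by (simp add: algebra_simps)
next
  case (ge2 n)
  have "lucas_U P Q (Suc (m + Suc (Suc n)))
      = P * lucas_U P Q (Suc (m + Suc n)) + Q * lucas_U P Q (Suc (m + n))"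
    by simp
  also have "\<dots> = lucas_U P Q (Suc m) * lucas_U P Q (Suc (Suc (Suc n)))
      + Q * lucas_U P Q m * lucas_U P Q (Suc (Suc n))"
    unfolding ge2 by (simp add: algebra_simps)
  finally show ?case .
qed simp

lemma coprime_lucas_U_Q:
  assumes "coprime P Q"
  shows "coprime (lucas_U P Q (Suc n)) Q"
proof (induction n)
  case (Suc n)
  have "gcd (lucas_U P Q (Suc (Suc n))) Q = gcd (P * lucas_U P Q (Suc n)) Q"
    using gcd_add_mult[of Q "lucas_U P Q n" "P * lucas_U P Q (Suc n)"]
    by (simp add: gcd.commute add.commute mult.commute)
  with Suc assms show ?case
    by (metis coprime_iff_gcd_eq_1 coprime_mult_left_iff)
qed simp

lemma coprime_lucas_U_Suc:
  assumes "coprime P Q"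
  shows "coprime (lucas_U P Q n) (lucas_U P Q (Suc n))"
proof (induction n)
  case (Suc n)
  have "gcd (lucas_U P Q (Suc n)) (lucas_U P Q (Suc (Suc n)))
      = gcd (lucas_U P Q (Suc n)) (Q * lucas_U P Q n)"
    using gcd_add_mult[of "lucas_U P Q (Suc n)" P "Q * lucas_U P Q n"]
    by (simp add: add.commute mult.commute)
  with Suc coprime_lucas_U_Q[OF assms, of n] show ?case
    by (metis coprime_iff_gcd_eq_1 coprime_mult_right_iff gcd.commute)
qed simp

lemma gcd_lucas_U_add:
  assumes "coprime P Q"
  shows "gcd (lucas_U P Q m) (lucas_U P Q (m + n)) = gcd (lucas_U P Q m) (lucas_U P Q n)"
proof (cases n)
  case (Suc k)
  have "lucas_U P Q (m + n) =
      Q * lucas_U P Q k * lucas_U P Q m + lucas_U P Q (Suc m) * lucas_U P Q n"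
    using lucas_U_add[of P Q m k] Suc by (simp add: algebra_simps)
  then have "gcd (lucas_U P Q m) (lucas_U P Q (m + n)) =
      gcd (lucas_U P Q m) (lucas_U P Q (Suc m) * lucas_U P Q n)"
    by (simp only: gcd_add_mult)
  also have "\<dots> = gcd (lucas_U P Q m) (lucas_U P Q n)"
    using coprime_lucas_U_Suc[OF assms, of m]
    by (simp add: gcd_mult_right_left_cancel del: lucas_U.simps)
  finally show ?thesis .
qed simp

lemma gcd_lucas_U:
  assumes "coprime P Q"
  shows "gcd (lucas_U P Q m) (lucas_U P Q n) = \<bar>lucas_U P Q (gcd m n)\<bar>"
proof (induction "m + n" arbitrary: m n rule: less_induct)
  case less
  have *: "gcd (lucas_U P Q k) (lucas_U P Q l) = \<bar>lucas_U P Q (gcd k l)\<bar>"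
    if "k + l = m + n" "k \<le> l" for k l
  proof (cases "k = 0")
    case False
    have "gcd (lucas_U P Q k) (lucas_U P Q (l - k)) = \<bar>lucas_U P Q (gcd k (l - k))\<bar>"
      using less[of k "l - k"] False that by simp
    moreover have "gcd k (l - k) = gcd k l"
      using that by (metis gcd.commute gcd_diff1_nat)
    ultimately show ?thesis
      using gcd_lucas_U_add[OF assms, of k "l - k"] le_add_diff_inverse[OF that(2)] by simp
  qed simp
  show ?case
    using *[of m n] *[of n m] by (cases "m \<le> n") (simp_all add: gcd.commute add.commute)
qed

lemma lucas_U_binet:
  fixes \<alpha> \<beta> :: "'a :: comm_ring_1"
  assumes "\<alpha> + \<beta> = of_int P" and "\<alpha> * \<beta> = - of_int Q"
  shows "(\<alpha> - \<beta>) * of_int (lucas_U P Q n) = \<alpha> ^ n - \<beta> ^ n"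
proof (induction n rule: induct_nat_012)
  case (ge2 n)
  have Q: "of_int Q = - (\<alpha> * \<beta>)" using assms(2) by simp
  have "(\<alpha> - \<beta>) * of_int (lucas_U P Q (Suc (Suc n)))
      = (\<alpha> + \<beta>) * ((\<alpha> - \<beta>) * of_int (lucas_U P Q (Suc n)))
        - \<alpha> * \<beta> * ((\<alpha> - \<beta>) * of_int (lucas_U P Q n))"
    by (simp add: assms(1)[symmetric] Q algebra_simps)
  also have "\<dots> = \<alpha> ^ Suc (Suc n) - \<beta> ^ Suc (Suc n)"
    unfolding ge2 by (simp add: algebra_simps)
  finally show ?case .
qed simp_all

lemma lucas_U_nonzero:
  assumes "lucas_nondegenerate P Q" and "n > 0"
  shows "lucas_U P Q n \<noteq> 0"
proof
  assume zero: "lucas_U P Q n = 0"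
  define s where "s = csqrt (of_int (P\<^sup>2 + 4 * Q))"
  define \<alpha> \<beta> where "\<alpha> = (of_int P + s) / 2" and "\<beta> = (of_int P - s) / 2"
  have s2: "s * s = of_int P * of_int P + 4 * of_int Q"
    unfolding s_def by (simp flip: power2_eq_square)
  have sum: "\<alpha> + \<beta> = of_int P"
    by (simp add: \<alpha>_def \<beta>_def field_simps)
  have "\<alpha> * \<beta> = (of_int P * of_int P - s * s) / 4"
    by (simp add: \<alpha>_def \<beta>_def field_simps)
  then have prod: "\<alpha> * \<beta> = - of_int Q"
    by (simp add: s2)
  have "[:- of_int Q, - of_int P, 1:] = [:- \<alpha>, 1:] * [:- \<beta>, 1:]"
    using sum prod by (simp add: algebra_simps flip: sum)
  then have not_root_of_unity: "(\<alpha> / \<beta>) ^ k \<noteq> 1" if "k > 0" for k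
    using assms(1) that unfolding lucas_nondegenerate_def by blast
  have "\<beta> \<noteq> 0"
    using prod assms(1) by (auto simp: lucas_nondegenerate_def)
  moreover have "\<alpha> ^ n = \<beta> ^ n"
    using lucas_U_binet[OF sum prod, of n] zero by simp
  ultimately show False
    using not_root_of_unity[OF assms(2)] by (simp add: power_divide)
qed

section \<open>Square classes of rational numbers\<close>

lemma sq_class_hom: "sq_class \<in> hom rat_units rat_square_classes"
proof -
  interpret comm_group rat_units by (rule comm_group_rat_units)
  interpret normal rat_squares rat_units
    by (rule subgroup_imp_normal[OF subgroup_rat_squares])
  show ?thesis
    using r_coset_hom_Mod unfolding sq_class_def[abs_def] rat_square_classes_def .
qed

lemma sq_class_closed: "x \<noteq> 0 \<Longrightarrow> sq_class x \<in> carrier rat_square_classes"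
  using hom_in_carrier[OF sq_class_hom] by (simp add: rat_units_def)

lemma sq_class_mult:
  "x \<noteq> 0 \<Longrightarrow> y \<noteq> 0 \<Longrightarrow> sq_class (x * y) = sq_class x \<otimes>\<^bsub>rat_square_classes\<^esub> sq_class y"
  using hom_mult[OF sq_class_hom, of x y] by (simp add: rat_units_def)

lemma sq_class_square:
  assumes "x \<noteq> 0"
  shows "sq_class (x\<^sup>2) = \<one>\<^bsub>rat_square_classes\<^esub>"
proof -
  interpret comm_group rat_units by (rule comm_group_rat_units)
  have "x\<^sup>2 \<in> rat_squares" using assms by (auto simp: rat_squares_def)
  then have "sq_class (x\<^sup>2) = rat_squares"
    unfolding sq_class_def
    using subgroup_rat_squares by (intro coset_join2) (auto dest: subgroup.mem_carrier)
  then show ?thesis by (simp add: rat_square_classes_def FactGroup_def)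
qed

lemma sq_class_mult_square:
  assumes "x \<noteq> 0" and "y \<noteq> 0"
  shows "sq_class (x * y\<^sup>2) = sq_class x"
proof -
  interpret comm_group rat_square_classes by (rule comm_group_rat_square_classes)
  show ?thesis
    using assms by (simp add: sq_class_mult sq_class_square sq_class_closed)
qed

lemma rat_square_classes_exponent_2:
  assumes "c \<in> carrier rat_square_classes"
  shows "c \<otimes>\<^bsub>rat_square_classes\<^esub> c = \<one>\<^bsub>rat_square_classes\<^esub>"
proof -
  obtain x where "x \<noteq> 0" "c = sq_class x"
    using assms
    by (auto simp: rat_square_classes_def carrier_FactGroup sq_class_def rat_units_def)
  then show ?thesis
    using sq_class_mult[of x x] sq_class_square[of x] by (simp add: power2_eq_square)
qed

section \<open>The group generated by the primes dividing an integer\<close>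

lemma (in comm_group) finite_generate_exponent_2:
  assumes "finite A" and "A \<subseteq> carrier G"
    and exponent: "\<And>x. x \<in> carrier G \<Longrightarrow> x \<otimes> x = \<one>"
  shows "finite (generate G A)"
  using assms(1,2)
proof (induction A rule: finite_induct)
  case empty
  then show ?case by (simp add: generate_empty)
next
  case (insert a A)
  define K where "K = generate G A"
  have a: "a \<in> carrier G" and A: "A \<subseteq> carrier G"
    using insert.prems by auto
  interpret K: subgroup K G
    unfolding K_def by (rule generate_is_subgroup[OF A])
  have self_inverse: "inv x = x" if "x \<in> carrier G" for x
    using exponent that by (intro inv_equality) auto
  have a_cancel: "a \<otimes> (a \<otimes> x) = x" if "x \<in> carrier G" for x
    using a that by (simp add: exponent flip: m_assoc)
  \<comment> \<open>Adjoining one generator adds at most one coset, so it at most doubles the group.\<close>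
  have "x \<in> K \<union> (\<otimes>) a ` K" if "x \<in> generate G (insert a A)" for x
    using that
  proof (induction rule: generate.induct)
    case one
    then show ?case by simp
  next
    case (incl h)
    have "a \<in> (\<otimes>) a ` K"
      using a by (intro image_eqI[of _ _ "\<one>"]) auto
    with incl show ?case by (auto simp: K_def intro: generate.incl)
  next
    case (inv h)
    have "a \<in> (\<otimes>) a ` K"
      using a by (intro image_eqI[of _ _ "\<one>"]) auto
    moreover have "inv h = h" using inv a A by (auto intro: self_inverse)
    ultimately show ?case using inv by (auto simp: K_def intro: generate.incl)
  next
    case (eng x y)
    have "(a \<otimes> k) \<otimes> l = a \<otimes> (k \<otimes> l)" "k \<otimes> (a \<otimes> l) = a \<otimes> (k \<otimes> l)"
      "(a \<otimes> k) \<otimes> (a \<otimes> l) = k \<otimes> l" if "k \<in> K" "l \<in> K" for k l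
      using a that[THEN K.mem_carrier] by (simp_all add: m_ac a_cancel)
    with eng.IH show ?case by auto
  qed
  then have "generate G (insert a A) \<subseteq> K \<union> (\<otimes>) a ` K" by blast
  moreover have "finite (K \<union> (\<otimes>) a ` K)"
    using insert.IH[OF A] by (simp add: K_def)
  ultimately show ?case by (rule finite_subset)
qed

lemma G_sub_generators_closed:
  "insert (sq_class (- 1)) {sq_class (of_int p) | p :: int. prime p \<and> p dvd D}
     \<subseteq> carrier rat_square_classes"
  by (auto intro!: sq_class_closed)

lemma subgroup_G_sub: "subgroup (G_sub D) rat_square_classes"
proof -
  interpret comm_group rat_square_classes by (rule comm_group_rat_square_classes)
  show ?thesis
    unfolding G_sub_def by (rule generate_is_subgroup[OF G_sub_generators_closed])
qed

lemma finite_G_sub: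
  assumes "D \<noteq> 0"
  shows "finite (G_sub D)"
proof -
  interpret comm_group rat_square_classes by (rule comm_group_rat_square_classes)
  have "finite {p :: int. prime p \<and> p dvd D}"
    using finite_divisors_int[OF assms] by (rule rev_finite_subset) auto
  then have "finite {sq_class (of_int p) | p :: int. prime p \<and> p dvd D}"
    by simp
  then show ?thesis
    unfolding G_sub_def
    by (intro finite_generate_exponent_2 G_sub_generators_closed rat_square_classes_exponent_2)
      simp_all
qed

lemma G_sub_mono: "D' dvd D \<Longrightarrow> G_sub D' \<subseteq> G_sub D"
proof -
  interpret comm_group rat_square_classes by (rule comm_group_rat_square_classes)
  assume "D' dvd D"
  then show ?thesis
    unfolding G_sub_def by (intro mono_generate) (auto intro: dvd_trans)
qed

text \<open>
  The descent is on \<open>\<bar>a\<bar>\<close>. The integer \<open>D\<close> varies with \<open>a\<close>: a prime dividing both is removed from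
  both, after which the group for the smaller \<open>D\<close> is contained in the original one.
\<close>

lemma sq_class_coprime_factor:
  fixes a b D y :: int
  assumes "coprime a b" and "a * b = D * y\<^sup>2" and "a \<noteq> 0"
  shows "sq_class (of_int a) \<in> G_sub D"
  using assms
proof (induction "nat \<bar>a\<bar>" arbitrary: a D y rule: less_induct)
  case less
  show ?case
  proof (cases "is_unit a")
    case True
    then consider "a = 1" | "a = - 1" by (auto simp: abs_if split: if_splits)
    then show ?thesis
    proof cases
      case 1
      then show ?thesis
        using sq_class_square[of 1] by (simp add: G_sub_def generate.one)
    next
      case 2
      then show ?thesis by (simp add: G_sub_def generate.incl)
    qed
  next
    case False
    then obtain q where q: "prime q" "q dvd a"
      using less.prems(3) prime_divisor_exists by blast
    have "q \<ge> 2" using q(1) by (rule prime_ge_2_int)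
    show ?thesis
    proof (cases "q dvd D")
      case True
      obtain a' D' where eq: "a = q * a'" "D = q * D'"
        using q(2) True by (auto elim!: dvdE)
      have "a' \<noteq> 0" using less.prems(3) eq by auto
      have "nat \<bar>a'\<bar> < nat \<bar>a\<bar>"
        using \<open>a' \<noteq> 0\<close> \<open>q \<ge> 2\<close> by (simp add: eq abs_mult)
      moreover have "coprime a' b" using less.prems(1) eq by simp
      moreover have "a' * b = D' * y\<^sup>2" using less.prems(2) eq \<open>q \<ge> 2\<close> by simp
      ultimately have "sq_class (of_int a') \<in> G_sub D'"
        using \<open>a' \<noteq> 0\<close> by (rule less.hyps)
      then have "sq_class (of_int a') \<in> G_sub D"
        using G_sub_mono[of D' D] eq by auto
      moreover have "sq_class (of_int q) \<in> G_sub D"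
        using q(1) True by (auto simp: G_sub_def intro!: generate.incl)
      ultimately show ?thesis
        using subgroup.m_closed[OF subgroup_G_sub] \<open>a' \<noteq> 0\<close> \<open>q \<ge> 2\<close> by (simp add: eq sq_class_mult)
    next
      case False
      \<comment> \<open>Here \<open>q\<close> must divide \<open>y\<close>, and coprimality puts the whole square \<open>q\<^sup>2\<close> into \<open>a\<close>.\<close>
      have "q dvd D * y\<^sup>2" using q(2) less.prems(2) by (metis dvd_mult2)
      then have "q dvd y" using False q(1) by (meson prime_dvd_mult_iff prime_dvd_power)
      then obtain y' where y: "y = q * y'" ..
      have "coprime q b" using less.prems(1) q(2) by (meson coprime_divisors dvd_refl)
      then have "coprime (q\<^sup>2) b" by simp
      moreover have "q\<^sup>2 dvd a * b" by (simp add: less.prems(2) y power_mult_distrib)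
      ultimately have "q\<^sup>2 dvd a" by (simp add: coprime_dvd_mult_left_iff)
      then obtain a' where eq: "a = q\<^sup>2 * a'" ..
      have "a' \<noteq> 0" using less.prems(3) eq by auto
      have "1 < q\<^sup>2" using \<open>q \<ge> 2\<close> by (simp add: one_less_power)
      then have "nat \<bar>a'\<bar> < nat \<bar>a\<bar>"
        using \<open>a' \<noteq> 0\<close> \<open>q \<ge> 2\<close> by (simp add: eq abs_mult)
      moreover have "coprime a' b" using less.prems(1) eq by simp
      moreover have "a' * b = D * y'\<^sup>2"
        using less.prems(2) \<open>q \<ge> 2\<close> by (simp add: eq y power_mult_distrib)
      ultimately have "sq_class (of_int a') \<in> G_sub D"
        using \<open>a' \<noteq> 0\<close> by (rule less.hyps)
      moreover have "sq_class (of_int a) = sq_class (of_int a')"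
        using sq_class_mult_square[of "of_int a'" "of_int q"] \<open>a' \<noteq> 0\<close> \<open>q \<ge> 2\<close>
        by (simp add: eq mult.commute)
      ultimately show ?thesis by simp
    qed
  qed
qed

section \<open>Square classes of terms with coprime indices\<close>

theorem corollary4p2:
  fixes P Q \<Delta> y :: int and m n :: nat
  assumes "Q = 1 \<or> Q = - 1"
    and "\<Delta> = P\<^sup>2 + 4 * Q"
    and "\<Delta> > 0"
    and "lucas_nondegenerate P Q"
    and "m > 0" and "n > 0"
    and "gcd m n = 1"
    and "\<Delta> * y\<^sup>2 = lucas_U P Q m * lucas_U P Q n"
  shows "sq_class (of_int (lucas_U P Q m)) \<in> G_sub \<Delta>
    \<and> sq_class (of_int (lucas_U P Q n)) \<in> G_sub \<Delta>
    \<and> sq_class (of_int (lucas_U P Q m)) \<otimes>\<^bsub>rat_square_classes\<^esub> sq_class (of_int (lucas_U P Q n))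
        = sq_class (of_int \<Delta>)
    \<and> finite (G_sub \<Delta>)"
proof -
  let ?a = "lucas_U P Q m" and ?b = "lucas_U P Q n"
  have "coprime P Q" using assms(1) by auto
  then have coprime: "coprime ?a ?b"
    using gcd_lucas_U[of P Q m n] assms(7) by (simp add: coprime_iff_gcd_eq_1)
  have a: "?a \<noteq> 0" and b: "?b \<noteq> 0"
    using lucas_U_nonzero[OF assms(4)] assms(5,6) by simp_all
  then have y: "y \<noteq> 0" using assms(8) by auto
  have "sq_class (of_int ?a) \<in> G_sub \<Delta>"
    by (rule sq_class_coprime_factor[OF coprime assms(8)[symmetric] a])
  moreover have "sq_class (of_int ?b) \<in> G_sub \<Delta>"
    using coprime assms(8) b
    by (intro sq_class_coprime_factor[of ?b ?a \<Delta> y]) (simp_all add: coprime_commute mult.commute)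
  moreover have "sq_class (of_int ?a) \<otimes>\<^bsub>rat_square_classes\<^esub> sq_class (of_int ?b)
      = sq_class (of_int \<Delta>)"
  proof -
    have "sq_class (of_int ?a) \<otimes>\<^bsub>rat_square_classes\<^esub> sq_class (of_int ?b)
        = sq_class (of_int (?a * ?b))"
      using a b by (simp add: sq_class_mult)
    also have "\<dots> = sq_class (of_int \<Delta> * (of_int y)\<^sup>2)"
      by (simp flip: assms(8))
    also have "\<dots> = sq_class (of_int \<Delta>)"
      using y assms(3) by (intro sq_class_mult_square) simp_all
    finally show ?thesis .
  qed
  moreover have "finite (G_sub \<Delta>)"
    using assms(3) by (intro finite_G_sub) simp
  ultimately show ?thesis by blast
qed

end
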